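(* Let $L$ be a Leibniz algebra and let $Z(L)$ be the center of $L$. If $Z(L)\subseteq Z^*(L)$, then $\omega(Z(E))=Z(L)$ for every stem extension $0\to\ker\omega\to E\xrightarrow{\omega}L\to 0$.
   Context: A (left) Leibniz algebra over a field $\mathbb{F}$ is an $\mathbb{F}$-vector space with a bilinear multiplication satisfying $x(yz)=(xy)z+y(xz)$. $E'$ is the span of all products in $E$; $Z(L)=\{z: zx=xz=0\ \forall x\in L\}$. An extension $0\to A\to B\to C\to0$ is a short exact sequence of Leibniz algebras and homomorphisms, with $A$ regarded as a subalgebra of $B$; it is central if $A\subseteq Z(B)$, and a stem extension is a central extension with $A\subseteq B'$. $Z^*(L)$ is the intersection of all images $\omega(Z(E))$ over all central extensions $0\to\ker\omega\to E\xrightarrow{\omega}L\to0$ of $L$. *)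

theory Defs
  imports "HOL-Algebra.AbelCoset" "HOL-Algebra.Module"
begin

text \<open>
  Leibniz algebras are carried by the record of \<^locale>\<open>module\<close>, whose multiplication slot
  holds the Leibniz product. The product need not be associative or unital, so the slot
  for the unit is present in the record but never used.
\<close>

locale leibniz_algebra = field F + module F L for F (structure) and L (structure) +
  assumes prod_closed:
      "\<lbrakk>x \<in> carrier L; y \<in> carrier L\<rbrakk> \<Longrightarrow> x \<otimes>\<^bsub>L\<^esub> y \<in> carrier L"
    and prod_add_left:
      "\<lbrakk>x \<in> carrier L; y \<in> carrier L; z \<in> carrier L\<rbrakk>
        \<Longrightarrow> (x \<oplus>\<^bsub>L\<^esub> y) \<otimes>\<^bsub>L\<^esub> z = x \<otimes>\<^bsub>L\<^esub> z \<oplus>\<^bsub>L\<^esub> y \<otimes>\<^bsub>L\<^esub> z"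
    and prod_add_right:
      "\<lbrakk>x \<in> carrier L; y \<in> carrier L; z \<in> carrier L\<rbrakk>
        \<Longrightarrow> x \<otimes>\<^bsub>L\<^esub> (y \<oplus>\<^bsub>L\<^esub> z) = x \<otimes>\<^bsub>L\<^esub> y \<oplus>\<^bsub>L\<^esub> x \<otimes>\<^bsub>L\<^esub> z"
    and prod_smult_left:
      "\<lbrakk>a \<in> carrier F; x \<in> carrier L; y \<in> carrier L\<rbrakk>
        \<Longrightarrow> (a \<odot>\<^bsub>L\<^esub> x) \<otimes>\<^bsub>L\<^esub> y = a \<odot>\<^bsub>L\<^esub> (x \<otimes>\<^bsub>L\<^esub> y)"
    and prod_smult_right:
      "\<lbrakk>a \<in> carrier F; x \<in> carrier L; y \<in> carrier L\<rbrakk>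
        \<Longrightarrow> x \<otimes>\<^bsub>L\<^esub> (a \<odot>\<^bsub>L\<^esub> y) = a \<odot>\<^bsub>L\<^esub> (x \<otimes>\<^bsub>L\<^esub> y)"
    and left_leibniz:
      "\<lbrakk>x \<in> carrier L; y \<in> carrier L; z \<in> carrier L\<rbrakk>
        \<Longrightarrow> x \<otimes>\<^bsub>L\<^esub> (y \<otimes>\<^bsub>L\<^esub> z) = (x \<otimes>\<^bsub>L\<^esub> y) \<otimes>\<^bsub>L\<^esub> z \<oplus>\<^bsub>L\<^esub> y \<otimes>\<^bsub>L\<^esub> (x \<otimes>\<^bsub>L\<^esub> z)"

definition leibniz_center :: "('f, 'l, 'm) module_scheme \<Rightarrow> 'l set" where
  "leibniz_center L =
     {z \<in> carrier L. \<forall>x \<in> carrier L. z \<otimes>\<^bsub>L\<^esub> x = \<zero>\<^bsub>L\<^esub> \<and> x \<otimes>\<^bsub>L\<^esub> z = \<zero>\<^bsub>L\<^esub>}"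

definition linear_span ::
    "('f, 'c) ring_scheme \<Rightarrow> ('f, 'l, 'm) module_scheme \<Rightarrow> 'l set \<Rightarrow> 'l set" where
  "linear_span F L S =
     {\<Oplus>\<^bsub>L\<^esub>s\<in>T. c s \<odot>\<^bsub>L\<^esub> s | T c. finite T \<and> T \<subseteq> S \<and> c \<in> T \<rightarrow> carrier F}"

definition leibniz_derived ::
    "('f, 'c) ring_scheme \<Rightarrow> ('f, 'l, 'm) module_scheme \<Rightarrow> 'l set" where
  "leibniz_derived F L =
     linear_span F L {x \<otimes>\<^bsub>L\<^esub> y | x y. x \<in> carrier L \<and> y \<in> carrier L}"

definition leibniz_hom ::
    "('f, 'c) ring_scheme \<Rightarrow> ('f, 'e, 'n) module_scheme \<Rightarrow> ('f, 'l, 'm) module_scheme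
      \<Rightarrow> ('e \<Rightarrow> 'l) set" where
  "leibniz_hom F E L =
     {h \<in> carrier E \<rightarrow> carrier L.
        (\<forall>x \<in> carrier E. \<forall>y \<in> carrier E. h (x \<oplus>\<^bsub>E\<^esub> y) = h x \<oplus>\<^bsub>L\<^esub> h y) \<and>
        (\<forall>a \<in> carrier F. \<forall>x \<in> carrier E. h (a \<odot>\<^bsub>E\<^esub> x) = a \<odot>\<^bsub>L\<^esub> h x) \<and>
        (\<forall>x \<in> carrier E. \<forall>y \<in> carrier E. h (x \<otimes>\<^bsub>E\<^esub> y) = h x \<otimes>\<^bsub>L\<^esub> h y)}"

text \<open>
  An extension of \<open>L\<close> is given by its projection \<open>\<omega>\<close>: exactness of
  \<open>0 \<rightarrow> ker \<omega> \<rightarrow> E \<rightarrow> L \<rightarrow> 0\<close>, with the kernel included as a subalgebra, amounts to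
  surjectivity of \<open>\<omega>\<close>.
\<close>

definition leibniz_extension ::
    "('f, 'c) ring_scheme \<Rightarrow> ('f, 'e, 'n) module_scheme \<Rightarrow> ('f, 'l, 'm) module_scheme
      \<Rightarrow> ('e \<Rightarrow> 'l) \<Rightarrow> bool" where
  "leibniz_extension F E L \<omega> \<longleftrightarrow>
     leibniz_algebra F E \<and> leibniz_algebra F L \<and>
     \<omega> \<in> leibniz_hom F E L \<and> \<omega> ` carrier E = carrier L"

definition central_extension ::
    "('f, 'c) ring_scheme \<Rightarrow> ('f, 'e, 'n) module_scheme \<Rightarrow> ('f, 'l, 'm) module_scheme
      \<Rightarrow> ('e \<Rightarrow> 'l) \<Rightarrow> bool" where
  "central_extension F E L \<omega> \<longleftrightarrow>
     leibniz_extension F E L \<omega> \<and> a_kernel E L \<omega> \<subseteq> leibniz_center E"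

definition stem_extension ::
    "('f, 'c) ring_scheme \<Rightarrow> ('f, 'e, 'n) module_scheme \<Rightarrow> ('f, 'l, 'm) module_scheme
      \<Rightarrow> ('e \<Rightarrow> 'l) \<Rightarrow> bool" where
  "stem_extension F E L \<omega> \<longleftrightarrow>
     central_extension F E L \<omega> \<and> a_kernel E L \<omega> \<subseteq> leibniz_derived F E"

text \<open>
  The intersection of all \<open>\<omega> (Z (E))\<close> ranges over a proper class, whereas a definition in HOL
  can only quantify over extensions \<open>E\<close> whose elements lie in one given type. The type
  \<open>'l \<times> 'f\<close> is large enough: \<open>Z_star_subset_image_center\<close> below shows that \<open>Z_star F L\<close> is
  contained in \<open>\<omega> (Z (E))\<close> for every central extension \<open>E\<close> of \<open>L\<close> over any type whatsoever, so
  \<open>Z_star F L\<close> is the intersection over all central extensions.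
\<close>

definition Z_star ::
    "('f, 'c) ring_scheme \<Rightarrow> ('f, 'l, 'm) module_scheme \<Rightarrow> 'l set" where
  "Z_star F L =
     \<Inter> {\<omega> ` leibniz_center E | (E :: ('f, 'l \<times> 'f) module) \<omega>. central_extension F E L \<omega>}"

text \<open>
  For the adequacy of \<^const>\<open>Z_star\<close>: a linear functional \<open>\<phi>\<close> on a central extension \<open>E\<close> of \<open>L\<close>
  yields a central extension on \<open>L \<times> F\<close> with cocycle \<open>(x, y) \<mapsto> \<phi> (s x \<cdot> s y)\<close>, where \<open>s\<close> is any
  section of the projection, and \<open>\<phi>\<close> can be chosen to detect a given nonzero product.
\<close>

lemma ex_linear_functional:
  fixes F (structure) and M (structure)
  assumes "field F" "module F M" and a: "a \<in> carrier M" "a \<noteq> \<zero>\<^bsub>M\<^esub>"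
  obtains \<phi> where "\<phi> \<in> carrier M \<rightarrow> carrier F" "\<phi> a = \<one>"
    "\<And>x y. x \<in> carrier M \<Longrightarrow> y \<in> carrier M \<Longrightarrow> \<phi> (x \<oplus>\<^bsub>M\<^esub> y) = \<phi> x \<oplus> \<phi> y"
    "\<And>c x. c \<in> carrier F \<Longrightarrow> x \<in> carrier M \<Longrightarrow> \<phi> (c \<odot>\<^bsub>M\<^esub> x) = c \<otimes> \<phi> x"
proof -
  interpret F: field F by fact
  interpret module F M by fact
  define sub where "sub H \<longleftrightarrow> H \<subseteq> carrier M \<and> \<zero>\<^bsub>M\<^esub> \<in> H \<and>
      (\<forall>x\<in>H. \<forall>y\<in>H. x \<oplus>\<^bsub>M\<^esub> y \<in> H) \<and> (\<forall>c\<in>carrier F. \<forall>x\<in>H. c \<odot>\<^bsub>M\<^esub> x \<in> H)" for H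
  define \<A> where "\<A> = {H. sub H \<and> a \<notin> H}"
  have "{\<zero>\<^bsub>M\<^esub>} \<in> \<A>" using a by (auto simp: \<A>_def sub_def)
  then have ne: "\<A> \<noteq> {}" by blast
  have "\<exists>H\<in>\<A>. \<forall>X\<in>\<A>. H \<subseteq> X \<longrightarrow> X = H"
  proof (rule subset_Zorn_nonempty[OF ne])
    fix C assume C: "C \<noteq> {}" "subset.chain \<A> C"
    have ch: "x \<subseteq> y \<or> y \<subseteq> x" if "x \<in> C" "y \<in> C" for x y
      using C(2) that by (auto simp: subset.chain_def)
    have CA: "\<And>H. H \<in> C \<Longrightarrow> sub H \<and> a \<notin> H"
      using C(2) by (auto simp: subset.chain_def \<A>_def)
    have s: "sub H" if "H \<in> C" for H using CA that by blast
    have "x \<oplus>\<^bsub>M\<^esub> y \<in> \<Union>C" if xy: "x \<in> \<Union>C" "y \<in> \<Union>C" for x y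
    proof -
      obtain X Y where X: "X \<in> C" "x \<in> X" and Y: "Y \<in> C" "y \<in> Y" using xy by blast
      show ?thesis
      proof (cases "X \<subseteq> Y")
        case True
        then have "x \<oplus>\<^bsub>M\<^esub> y \<in> Y" using X Y s[OF Y(1)] by (auto simp: sub_def)
        then show ?thesis using Y by blast
      next
        case False
        then have "Y \<subseteq> X" using ch X Y by blast
        then have "x \<oplus>\<^bsub>M\<^esub> y \<in> X" using X Y s[OF X(1)] by (auto simp: sub_def)
        then show ?thesis using X by blast
      qed
    qed
    moreover have "\<Union>C \<subseteq> carrier M" "\<zero>\<^bsub>M\<^esub> \<in> \<Union>C"
      "\<forall>c\<in>carrier F. \<forall>x\<in>\<Union>C. c \<odot>\<^bsub>M\<^esub> x \<in> \<Union>C"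
      using s C(1) unfolding sub_def by blast+
    ultimately have "sub (\<Union>C)" unfolding sub_def by blast
    then show "\<Union>C \<in> \<A>" using CA by (auto simp: \<A>_def)
  qed
  then obtain H where H: "sub H" "a \<notin> H" and max: "\<And>X. sub X \<Longrightarrow> a \<notin> X \<Longrightarrow> H \<subseteq> X \<Longrightarrow> X = H"
    unfolding \<A>_def by blast
  have Hc: "\<And>x. x \<in> H \<Longrightarrow> x \<in> carrier M" and H0: "\<zero>\<^bsub>M\<^esub> \<in> H"
    and Ha: "\<And>x y. x \<in> H \<Longrightarrow> y \<in> H \<Longrightarrow> x \<oplus>\<^bsub>M\<^esub> y \<in> H"
    and Hs: "\<And>c x. c \<in> carrier F \<Longrightarrow> x \<in> H \<Longrightarrow> c \<odot>\<^bsub>M\<^esub> x \<in> H"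
    using H(1) unfolding sub_def by blast+
  have inv: "\<exists>d\<in>carrier F. d \<otimes> c = \<one>" if "c \<in> carrier F" "c \<noteq> \<zero>" for c
    using that F.field_Units F.Units_l_inv_ex by blast
  have Hneg: "\<ominus>\<^bsub>M\<^esub> x \<in> H" if "x \<in> H" for x
    using Hs[of "\<ominus> \<one>" x] that Hc by (simp add: smult_l_minus)
  have ex: "\<exists>c\<in>carrier F. \<exists>h\<in>H. v = h \<oplus>\<^bsub>M\<^esub> c \<odot>\<^bsub>M\<^esub> a" if v: "v \<in> carrier M" for v
  proof (cases "v \<in> H")
    case True
    then show ?thesis using v a by (intro bexI[of _ \<zero>] bexI[of _ v]) auto
  next
    case False
    define X where "X = {h \<oplus>\<^bsub>M\<^esub> c \<odot>\<^bsub>M\<^esub> v | h c. h \<in> H \<and> c \<in> carrier F}"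
    have XI: "\<And>h c. h \<in> H \<Longrightarrow> c \<in> carrier F \<Longrightarrow> h \<oplus>\<^bsub>M\<^esub> c \<odot>\<^bsub>M\<^esub> v \<in> X"
      unfolding X_def by blast
    have HX: "H \<subseteq> X"
    proof
      fix h assume "h \<in> H"
      then show "h \<in> X" using XI[of h \<zero>] v Hc by simp
    qed
    have "v \<in> X" using XI[OF H0, of \<one>] v by simp
    have "x \<oplus>\<^bsub>M\<^esub> y \<in> X" if xy: "x \<in> X" "y \<in> X" for x y
    proof -
      obtain h c k d where x: "x = h \<oplus>\<^bsub>M\<^esub> c \<odot>\<^bsub>M\<^esub> v" "h \<in> H" "c \<in> carrier F"
        and y: "y = k \<oplus>\<^bsub>M\<^esub> d \<odot>\<^bsub>M\<^esub> v" "k \<in> H" "d \<in> carrier F"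
        using xy unfolding X_def by blast
      have "x \<oplus>\<^bsub>M\<^esub> y = (h \<oplus>\<^bsub>M\<^esub> k) \<oplus>\<^bsub>M\<^esub> (c \<oplus> d) \<odot>\<^bsub>M\<^esub> v"
        using x y v Hc by (simp add: smult_l_distr M.a_ac)
      then show ?thesis using XI Ha x y by simp
    qed
    moreover have "c \<odot>\<^bsub>M\<^esub> x \<in> X" if cx: "c \<in> carrier F" "x \<in> X" for x c
    proof -
      obtain h d where x: "x = h \<oplus>\<^bsub>M\<^esub> d \<odot>\<^bsub>M\<^esub> v" "h \<in> H" "d \<in> carrier F"
        using cx unfolding X_def by blast
      have "c \<odot>\<^bsub>M\<^esub> x = c \<odot>\<^bsub>M\<^esub> h \<oplus>\<^bsub>M\<^esub> (c \<otimes> d) \<odot>\<^bsub>M\<^esub> v"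
        using x v Hc that by (simp add: smult_r_distr smult_assoc1)
      then show ?thesis using XI Hs x that by simp
    qed
    moreover have "X \<subseteq> carrier M" using v Hc by (auto simp: X_def)
    ultimately have "sub X" using HX H0 unfolding sub_def by blast
    then have "a \<in> X" using max[of X] HX False \<open>v \<in> X\<close> by blast
    then obtain h c where hc: "a = h \<oplus>\<^bsub>M\<^esub> c \<odot>\<^bsub>M\<^esub> v" "h \<in> H" "c \<in> carrier F"
      unfolding X_def by blast
    have "c \<noteq> \<zero>" using hc H(2) v Hc by auto
    then obtain d where d: "d \<in> carrier F" "d \<otimes> c = \<one>" using inv hc by blast
    have "d \<odot>\<^bsub>M\<^esub> a = d \<odot>\<^bsub>M\<^esub> h \<oplus>\<^bsub>M\<^esub> v"
      using hc d v Hc by (simp add: smult_r_distr smult_assoc1[symmetric])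
    then have "v = \<ominus>\<^bsub>M\<^esub> (d \<odot>\<^bsub>M\<^esub> h) \<oplus>\<^bsub>M\<^esub> d \<odot>\<^bsub>M\<^esub> a"
      using hc(2) d v Hc by (simp add: M.r_neg1 smult_closed)
    then show ?thesis using d hc(2) Hs Hneg by blast
  qed
  have uniq: "c = d" if "h \<in> H" "k \<in> H" "c \<in> carrier F" "d \<in> carrier F"
    "h \<oplus>\<^bsub>M\<^esub> c \<odot>\<^bsub>M\<^esub> a = k \<oplus>\<^bsub>M\<^esub> d \<odot>\<^bsub>M\<^esub> a" for h k c d
  proof (rule ccontr)
    assume "c \<noteq> d"
    moreover have cd: "c \<ominus> d \<in> carrier F" using that F.minus_closed by blast
    moreover have "c = (c \<ominus> d) \<oplus> d" using that by (simp add: F.minus_eq F.a_assoc F.l_neg)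
    ultimately have "c \<ominus> d \<noteq> \<zero>" using that by auto
    then obtain e where e: "e \<in> carrier F" "e \<otimes> (c \<ominus> d) = \<one>" using inv cd by blast
    have "(c \<ominus> d) \<odot>\<^bsub>M\<^esub> a = c \<odot>\<^bsub>M\<^esub> a \<oplus>\<^bsub>M\<^esub> \<ominus>\<^bsub>M\<^esub> (d \<odot>\<^bsub>M\<^esub> a)"
      using that a by (simp add: F.minus_eq smult_l_distr smult_l_minus)
    also have "c \<odot>\<^bsub>M\<^esub> a = \<ominus>\<^bsub>M\<^esub> h \<oplus>\<^bsub>M\<^esub> (h \<oplus>\<^bsub>M\<^esub> c \<odot>\<^bsub>M\<^esub> a)"
      using that(1-4) a Hc by (simp add: M.r_neg1)
    also have "\<dots> = \<ominus>\<^bsub>M\<^esub> h \<oplus>\<^bsub>M\<^esub> (k \<oplus>\<^bsub>M\<^esub> d \<odot>\<^bsub>M\<^esub> a)" using that(5) by simp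
    also have "\<dots> \<oplus>\<^bsub>M\<^esub> \<ominus>\<^bsub>M\<^esub> (d \<odot>\<^bsub>M\<^esub> a) = \<ominus>\<^bsub>M\<^esub> h \<oplus>\<^bsub>M\<^esub> k"
      using that(1-4) a Hc by (simp add: M.a_assoc M.r_neg)
    finally have "(c \<ominus> d) \<odot>\<^bsub>M\<^esub> a \<in> H" using that(1,2) Ha Hneg by simp
    then have "e \<odot>\<^bsub>M\<^esub> ((c \<ominus> d) \<odot>\<^bsub>M\<^esub> a) \<in> H" using Hs e by blast
    then show False using e a cd H(2) by (simp add: smult_assoc1[symmetric])
  qed
  define \<phi> where "\<phi> v = (SOME c. c \<in> carrier F \<and> (\<exists>h\<in>H. v = h \<oplus>\<^bsub>M\<^esub> c \<odot>\<^bsub>M\<^esub> a))" for v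
  have \<phi>: "\<phi> v \<in> carrier F \<and> (\<exists>h\<in>H. v = h \<oplus>\<^bsub>M\<^esub> \<phi> v \<odot>\<^bsub>M\<^esub> a)" if "v \<in> carrier M" for v
    unfolding \<phi>_def by (rule someI_ex) (use ex[OF that] in blast)
  have \<phi>_eq: "\<phi> v = c" if "v \<in> carrier M" "c \<in> carrier F" "h \<in> H" "v = h \<oplus>\<^bsub>M\<^esub> c \<odot>\<^bsub>M\<^esub> a" for v c h
    using \<phi>[OF that(1)] that uniq by metis
  show thesis
  proof
    show "\<phi> \<in> carrier M \<rightarrow> carrier F" using \<phi> by blast
    show "\<phi> a = \<one>" using a H0 by (intro \<phi>_eq[of _ _ "\<zero>\<^bsub>M\<^esub>"]) auto
  next
    fix x y assume xy: "x \<in> carrier M" "y \<in> carrier M"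
    obtain h k where h: "h \<in> H" "x = h \<oplus>\<^bsub>M\<^esub> \<phi> x \<odot>\<^bsub>M\<^esub> a" and k: "k \<in> H" "y = k \<oplus>\<^bsub>M\<^esub> \<phi> y \<odot>\<^bsub>M\<^esub> a"
      and c: "\<phi> x \<in> carrier F" "\<phi> y \<in> carrier F"
      using \<phi> xy by blast
    have "x \<oplus>\<^bsub>M\<^esub> y = (h \<oplus>\<^bsub>M\<^esub> \<phi> x \<odot>\<^bsub>M\<^esub> a) \<oplus>\<^bsub>M\<^esub> (k \<oplus>\<^bsub>M\<^esub> \<phi> y \<odot>\<^bsub>M\<^esub> a)"
      using h(2) k(2) by simp
    also have "\<dots> = (h \<oplus>\<^bsub>M\<^esub> k) \<oplus>\<^bsub>M\<^esub> (\<phi> x \<oplus> \<phi> y) \<odot>\<^bsub>M\<^esub> a"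
      using h(1) k(1) c a Hc by (simp add: smult_l_distr M.a_ac)
    finally show "\<phi> (x \<oplus>\<^bsub>M\<^esub> y) = \<phi> x \<oplus> \<phi> y"
      using xy c a(1) Hc Ha h(1) k(1) by (intro \<phi>_eq) auto
  next
    fix c x assume cx: "c \<in> carrier F" "x \<in> carrier M"
    obtain h where h: "h \<in> H" "x = h \<oplus>\<^bsub>M\<^esub> \<phi> x \<odot>\<^bsub>M\<^esub> a" and d: "\<phi> x \<in> carrier F"
      using \<phi> cx by blast
    have "c \<odot>\<^bsub>M\<^esub> x = c \<odot>\<^bsub>M\<^esub> (h \<oplus>\<^bsub>M\<^esub> \<phi> x \<odot>\<^bsub>M\<^esub> a)" using h(2) by simp
    also have "\<dots> = c \<odot>\<^bsub>M\<^esub> h \<oplus>\<^bsub>M\<^esub> (c \<otimes> \<phi> x) \<odot>\<^bsub>M\<^esub> a"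
      using h(1) d a cx Hc by (simp add: smult_r_distr smult_assoc1)
    finally show "\<phi> (c \<odot>\<^bsub>M\<^esub> x) = c \<otimes> \<phi> x"
      using cx d a(1) Hc Hs h(1) by (intro \<phi>_eq) auto
  qed
qed

lemma cocycle_extension:
  fixes F :: "('f, 'c) ring_scheme" (structure) and L :: "('f, 'l, 'm) module_scheme"
    and E :: "('f, 'e, 'n) module_scheme"
  assumes ext: "central_extension F E L \<omega>"
    and \<phi>: "\<phi> \<in> carrier E \<rightarrow> carrier F"
    and \<phi>_add: "\<And>x y. x \<in> carrier E \<Longrightarrow> y \<in> carrier E \<Longrightarrow> \<phi> (x \<oplus>\<^bsub>E\<^esub> y) = \<phi> x \<oplus> \<phi> y"
    and \<phi>_smult: "\<And>c x. c \<in> carrier F \<Longrightarrow> x \<in> carrier E \<Longrightarrow> \<phi> (c \<odot>\<^bsub>E\<^esub> x) = c \<otimes> \<phi> x"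
  obtains E' :: "('f, 'l \<times> 'f) module" where
    "central_extension F E' L fst" "carrier E' = carrier L \<times> carrier F" "\<zero>\<^bsub>E'\<^esub> = (\<zero>\<^bsub>L\<^esub>, \<zero>)"
    "\<And>x y s t. x \<in> carrier E \<Longrightarrow> y \<in> carrier E \<Longrightarrow>
       (\<omega> x, s) \<otimes>\<^bsub>E'\<^esub> (\<omega> y, t) = (\<omega> (x \<otimes>\<^bsub>E\<^esub> y), \<phi> (x \<otimes>\<^bsub>E\<^esub> y))"
proof -
  from ext have algE: "leibniz_algebra F E" and algL: "leibniz_algebra F L"
    and hom: "\<omega> \<in> leibniz_hom F E L" and surj: "\<omega> ` carrier E = carrier L"
    and ker: "a_kernel E L \<omega> \<subseteq> leibniz_center E"
    unfolding central_extension_def leibniz_extension_def by auto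
  interpret F: field F by (rule leibniz_algebra.axioms(1)[OF algE])
  interpret E: leibniz_algebra F E by fact
  interpret L: leibniz_algebra F L by fact
  have w: "\<And>x. x \<in> carrier E \<Longrightarrow> \<omega> x \<in> carrier L"
    and w_add: "\<And>x y. x \<in> carrier E \<Longrightarrow> y \<in> carrier E \<Longrightarrow> \<omega> (x \<oplus>\<^bsub>E\<^esub> y) = \<omega> x \<oplus>\<^bsub>L\<^esub> \<omega> y"
    and w_smult: "\<And>a x. a \<in> carrier F \<Longrightarrow> x \<in> carrier E \<Longrightarrow> \<omega> (a \<odot>\<^bsub>E\<^esub> x) = a \<odot>\<^bsub>L\<^esub> \<omega> x"
    and w_prod: "\<And>x y. x \<in> carrier E \<Longrightarrow> y \<in> carrier E \<Longrightarrow> \<omega> (x \<otimes>\<^bsub>E\<^esub> y) = \<omega> x \<otimes>\<^bsub>L\<^esub> \<omega> y"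
    using hom unfolding leibniz_hom_def by auto
  have \<phi>c: "\<And>x. x \<in> carrier E \<Longrightarrow> \<phi> x \<in> carrier F" using \<phi> by auto
  have same: "\<exists>k\<in>leibniz_center E. x = y \<oplus>\<^bsub>E\<^esub> k"
    if xy: "x \<in> carrier E" "y \<in> carrier E" "\<omega> x = \<omega> y" for x y
  proof -
    let ?k = "\<ominus>\<^bsub>E\<^esub> y \<oplus>\<^bsub>E\<^esub> x"
    have kc: "?k \<in> carrier E" using xy by simp
    have eq: "x = y \<oplus>\<^bsub>E\<^esub> ?k" using xy by (simp add: E.M.r_neg2)
    then have "\<omega> y \<oplus>\<^bsub>L\<^esub> \<omega> ?k = \<omega> y" using w_add[OF xy(2) kc] xy(3) by simp
    then have "\<omega> ?k = \<zero>\<^bsub>L\<^esub>" using w[OF xy(2)] w[OF kc]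
        L.M.r_neg1[of "\<omega> y" "\<omega> ?k"] by (simp add: L.M.l_neg)
    then have "?k \<in> leibniz_center E" using ker kc by (auto simp: a_kernel_def')
    then show ?thesis using eq by blast
  qed
  have prod_same: "x \<otimes>\<^bsub>E\<^esub> y = x' \<otimes>\<^bsub>E\<^esub> y'"
    if xy: "x \<in> carrier E" "y \<in> carrier E" "x' \<in> carrier E" "y' \<in> carrier E"
      "\<omega> x = \<omega> x'" "\<omega> y = \<omega> y'" for x y x' y'
  proof -
    obtain k l where k: "k \<in> leibniz_center E" "x = x' \<oplus>\<^bsub>E\<^esub> k" and
      l: "l \<in> leibniz_center E" "y = y' \<oplus>\<^bsub>E\<^esub> l" using same xy by meson
    have kl: "k \<in> carrier E" "l \<in> carrier E" using k l by (auto simp: leibniz_center_def)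
    have "x \<otimes>\<^bsub>E\<^esub> y = x' \<otimes>\<^bsub>E\<^esub> y \<oplus>\<^bsub>E\<^esub> k \<otimes>\<^bsub>E\<^esub> y"
      using E.prod_add_left[of x' k y] xy k kl by simp
    also have "k \<otimes>\<^bsub>E\<^esub> y = \<zero>\<^bsub>E\<^esub>" using k xy by (auto simp: leibniz_center_def)
    also have "x' \<otimes>\<^bsub>E\<^esub> y = x' \<otimes>\<^bsub>E\<^esub> y' \<oplus>\<^bsub>E\<^esub> x' \<otimes>\<^bsub>E\<^esub> l"
      using E.prod_add_right[of x' y' l] xy l kl by simp
    also have "x' \<otimes>\<^bsub>E\<^esub> l = \<zero>\<^bsub>E\<^esub>" using l xy by (auto simp: leibniz_center_def)
    finally show ?thesis using xy E.prod_closed by simp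
  qed
  define s where "s = inv_into (carrier E) \<omega>"
  have s: "s x \<in> carrier E" "\<omega> (s x) = x" if "x \<in> carrier L" for x
    using that surj unfolding s_def by (auto intro: inv_into_into f_inv_into_f)
  define f where "f x y = \<phi> (s x \<otimes>\<^bsub>E\<^esub> s y)" for x y
  have f: "f (\<omega> x) (\<omega> y) = \<phi> (x \<otimes>\<^bsub>E\<^esub> y)" if "x \<in> carrier E" "y \<in> carrier E" for x y
    unfolding f_def using prod_same[of "s (\<omega> x)" "s (\<omega> y)" x y] s w that by simp
  define E' :: "('f, 'l \<times> 'f) module" where
    "E' = \<lparr>carrier = carrier L \<times> carrier F,
           mult = (\<lambda>p q. (fst p \<otimes>\<^bsub>L\<^esub> fst q, f (fst p) (fst q))),
           one = undefined, zero = (\<zero>\<^bsub>L\<^esub>, \<zero>),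
           add = (\<lambda>p q. (fst p \<oplus>\<^bsub>L\<^esub> fst q, snd p \<oplus> snd q)),
           smult = (\<lambda>c p. (c \<odot>\<^bsub>L\<^esub> fst p, c \<otimes> snd p))\<rparr>"
  have sel: "carrier E' = carrier L \<times> carrier F" "\<zero>\<^bsub>E'\<^esub> = (\<zero>\<^bsub>L\<^esub>, \<zero>)"
    "\<And>p q. p \<otimes>\<^bsub>E'\<^esub> q = (fst p \<otimes>\<^bsub>L\<^esub> fst q, f (fst p) (fst q))"
    "\<And>p q. p \<oplus>\<^bsub>E'\<^esub> q = (fst p \<oplus>\<^bsub>L\<^esub> fst q, snd p \<oplus> snd q)"
    "\<And>c p. c \<odot>\<^bsub>E'\<^esub> p = (c \<odot>\<^bsub>L\<^esub> fst p, c \<otimes> snd p)"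
    by (simp_all add: E'_def)
  have lift: "\<exists>e\<in>carrier E. x = \<omega> e" if "x \<in> carrier L" for x using that surj by blast
  have fc: "f x y \<in> carrier F" if xy: "x \<in> carrier L" "y \<in> carrier L" for x y
    using s xy by (simp add: f_def \<phi>c E.prod_closed)
  have f_addl: "f (x \<oplus>\<^bsub>L\<^esub> y) z = f x z \<oplus> f y z"
    if xyz: "x \<in> carrier L" "y \<in> carrier L" "z \<in> carrier L" for x y z
  proof -
    obtain u v t where uv: "x = \<omega> u" "y = \<omega> v" "z = \<omega> t" "u \<in> carrier E" "v \<in> carrier E" "t \<in> carrier E"
      using lift xyz by meson
    have "f (x \<oplus>\<^bsub>L\<^esub> y) z = \<phi> ((u \<oplus>\<^bsub>E\<^esub> v) \<otimes>\<^bsub>E\<^esub> t)" using uv f[of "u \<oplus>\<^bsub>E\<^esub> v" t] by (simp add: w_add)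
    then show ?thesis using uv by (simp add: f E.prod_add_left \<phi>_add E.prod_closed)
  qed
  have f_addr: "f z (x \<oplus>\<^bsub>L\<^esub> y) = f z x \<oplus> f z y"
    if xyz: "x \<in> carrier L" "y \<in> carrier L" "z \<in> carrier L" for x y z
  proof -
    obtain u v t where uv: "x = \<omega> u" "y = \<omega> v" "z = \<omega> t" "u \<in> carrier E" "v \<in> carrier E" "t \<in> carrier E"
      using lift xyz by meson
    have "f z (x \<oplus>\<^bsub>L\<^esub> y) = \<phi> (t \<otimes>\<^bsub>E\<^esub> (u \<oplus>\<^bsub>E\<^esub> v))" using uv f[of t "u \<oplus>\<^bsub>E\<^esub> v"] by (simp add: w_add)
    then show ?thesis using uv by (simp add: f E.prod_add_right \<phi>_add E.prod_closed)
  qed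
  have f_sml: "f (c \<odot>\<^bsub>L\<^esub> x) y = c \<otimes> f x y"
    if xyz: "x \<in> carrier L" "y \<in> carrier L" "c \<in> carrier F" for x y c
  proof -
    obtain u v where uv: "x = \<omega> u" "y = \<omega> v" "u \<in> carrier E" "v \<in> carrier E"
      using lift xyz by meson
    have "f (c \<odot>\<^bsub>L\<^esub> x) y = \<phi> ((c \<odot>\<^bsub>E\<^esub> u) \<otimes>\<^bsub>E\<^esub> v)" using uv xyz f[of "c \<odot>\<^bsub>E\<^esub> u" v] by (simp add: w_smult)
    then show ?thesis using uv xyz by (simp add: f E.prod_smult_left \<phi>_smult E.prod_closed)
  qed
  have f_smr: "f x (c \<odot>\<^bsub>L\<^esub> y) = c \<otimes> f x y"
    if xyz: "x \<in> carrier L" "y \<in> carrier L" "c \<in> carrier F" for x y c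
  proof -
    obtain u v where uv: "x = \<omega> u" "y = \<omega> v" "u \<in> carrier E" "v \<in> carrier E"
      using lift xyz by meson
    have "f x (c \<odot>\<^bsub>L\<^esub> y) = \<phi> (u \<otimes>\<^bsub>E\<^esub> (c \<odot>\<^bsub>E\<^esub> v))" using uv xyz f[of u "c \<odot>\<^bsub>E\<^esub> v"] by (simp add: w_smult)
    then show ?thesis using uv xyz by (simp add: f E.prod_smult_right \<phi>_smult E.prod_closed)
  qed
  have f_leib: "f x (y \<otimes>\<^bsub>L\<^esub> z) = f (x \<otimes>\<^bsub>L\<^esub> y) z \<oplus> f y (x \<otimes>\<^bsub>L\<^esub> z)"
    if xyz: "x \<in> carrier L" "y \<in> carrier L" "z \<in> carrier L" for x y z
  proof -
    obtain u v t where uv: "x = \<omega> u" "y = \<omega> v" "z = \<omega> t" "u \<in> carrier E" "v \<in> carrier E" "t \<in> carrier E"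
      using lift xyz by meson
    have "f x (y \<otimes>\<^bsub>L\<^esub> z) = \<phi> (u \<otimes>\<^bsub>E\<^esub> (v \<otimes>\<^bsub>E\<^esub> t))" "f (x \<otimes>\<^bsub>L\<^esub> y) z = \<phi> ((u \<otimes>\<^bsub>E\<^esub> v) \<otimes>\<^bsub>E\<^esub> t)"
      "f y (x \<otimes>\<^bsub>L\<^esub> z) = \<phi> (v \<otimes>\<^bsub>E\<^esub> (u \<otimes>\<^bsub>E\<^esub> t))"
      using uv f[of u "v \<otimes>\<^bsub>E\<^esub> t"] f[of "u \<otimes>\<^bsub>E\<^esub> v" t] f[of v "u \<otimes>\<^bsub>E\<^esub> t"]
      by (simp_all add: w_prod E.prod_closed)
    then show ?thesis using uv E.left_leibniz[of u v t] by (simp add: \<phi>_add E.prod_closed)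
  qed
  have grp: "abelian_group E'"
  proof (rule abelian_groupI)
    fix p assume "p \<in> carrier E'"
    then show "\<exists>q\<in>carrier E'. q \<oplus>\<^bsub>E'\<^esub> p = \<zero>\<^bsub>E'\<^esub>"
      by (intro bexI[of _ "(\<ominus>\<^bsub>L\<^esub> fst p, \<ominus> snd p)"]) (auto simp: sel L.M.l_neg F.l_neg)
  qed (auto simp: sel L.M.a_ac F.a_ac)
  have mod: "module F E'"
  proof (rule moduleI[OF F.cring_axioms grp])
  qed (auto simp: sel L.smult_l_distr L.smult_r_distr L.smult_assoc1
        F.l_distr F.r_distr F.m_assoc simp del: F.l_minus F.r_minus)
  have alg': "leibniz_algebra F E'"
  proof (intro leibniz_algebra.intro leibniz_algebra_axioms.intro mod F.field_axioms)
    fix p q assume "p \<in> carrier E'" "q \<in> carrier E'"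
    then show "p \<otimes>\<^bsub>E'\<^esub> q \<in> carrier E'" by (clarsimp simp: sel L.prod_closed fc)
  next
    fix p q r assume "p \<in> carrier E'" "q \<in> carrier E'" "r \<in> carrier E'"
    then show "(p \<oplus>\<^bsub>E'\<^esub> q) \<otimes>\<^bsub>E'\<^esub> r = p \<otimes>\<^bsub>E'\<^esub> r \<oplus>\<^bsub>E'\<^esub> q \<otimes>\<^bsub>E'\<^esub> r"
      by (clarsimp simp: sel L.prod_add_left f_addl)
  next
    fix p q r assume "p \<in> carrier E'" "q \<in> carrier E'" "r \<in> carrier E'"
    then show "p \<otimes>\<^bsub>E'\<^esub> (q \<oplus>\<^bsub>E'\<^esub> r) = p \<otimes>\<^bsub>E'\<^esub> q \<oplus>\<^bsub>E'\<^esub> p \<otimes>\<^bsub>E'\<^esub> r"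
      by (clarsimp simp: sel L.prod_add_right f_addr)
  next
    fix c p q assume "c \<in> carrier F" "p \<in> carrier E'" "q \<in> carrier E'"
    then show "(c \<odot>\<^bsub>E'\<^esub> p) \<otimes>\<^bsub>E'\<^esub> q = c \<odot>\<^bsub>E'\<^esub> (p \<otimes>\<^bsub>E'\<^esub> q)"
      by (clarsimp simp: sel L.prod_smult_left f_sml)
  next
    fix c p q assume "c \<in> carrier F" "p \<in> carrier E'" "q \<in> carrier E'"
    then show "p \<otimes>\<^bsub>E'\<^esub> (c \<odot>\<^bsub>E'\<^esub> q) = c \<odot>\<^bsub>E'\<^esub> (p \<otimes>\<^bsub>E'\<^esub> q)"
      by (clarsimp simp: sel L.prod_smult_right f_smr)
  next
    fix p q r assume "p \<in> carrier E'" "q \<in> carrier E'" "r \<in> carrier E'"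
    then have "fst p \<in> carrier L" "fst q \<in> carrier L" "fst r \<in> carrier L" by (auto simp: sel)
    then show "p \<otimes>\<^bsub>E'\<^esub> (q \<otimes>\<^bsub>E'\<^esub> r) = (p \<otimes>\<^bsub>E'\<^esub> q) \<otimes>\<^bsub>E'\<^esub> r \<oplus>\<^bsub>E'\<^esub> q \<otimes>\<^bsub>E'\<^esub> (p \<otimes>\<^bsub>E'\<^esub> r)"
      using L.left_leibniz[of "fst p" "fst q" "fst r"] f_leib[of "fst p" "fst q" "fst r"]
      by (simp add: sel)
  qed
  have f0: "f \<zero>\<^bsub>L\<^esub> x = \<zero>" "f x \<zero>\<^bsub>L\<^esub> = \<zero>" "\<zero>\<^bsub>L\<^esub> \<otimes>\<^bsub>L\<^esub> x = \<zero>\<^bsub>L\<^esub>" "x \<otimes>\<^bsub>L\<^esub> \<zero>\<^bsub>L\<^esub> = \<zero>\<^bsub>L\<^esub>"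
    if "x \<in> carrier L" for x
    using that f_sml[of x x \<zero>] f_smr[of x x \<zero>] L.prod_smult_left[of \<zero> x x] L.prod_smult_right[of \<zero> x x]
    by (simp_all add: fc L.prod_closed)
  show thesis
  proof
    show "central_extension F E' L fst"
      unfolding central_extension_def leibniz_extension_def
    proof (intro conjI alg' algL)
      show "fst \<in> leibniz_hom F E' L" by (auto simp: leibniz_hom_def sel)
      have "\<zero> \<in> carrier F" by simp
      then show "fst ` carrier E' = carrier L" by (auto simp: sel fst_image_times)
      show "a_kernel E' L fst \<subseteq> leibniz_center E'"
        by (auto simp: a_kernel_def' leibniz_center_def sel f0)
    qed
  next
    fix x y t r assume "x \<in> carrier E" "y \<in> carrier E"
    then show "(\<omega> x, t) \<otimes>\<^bsub>E'\<^esub> (\<omega> y, r) = (\<omega> (x \<otimes>\<^bsub>E\<^esub> y), \<phi> (x \<otimes>\<^bsub>E\<^esub> y))"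
      by (simp add: sel f w_prod)
  qed (simp_all add: sel)
qed

theorem Z_star_subset_image_center:
  fixes F :: "('f, 'c) ring_scheme" (structure) and L :: "('f, 'l, 'm) module_scheme"
    and E :: "('f, 'e, 'n) module_scheme"
  assumes ext: "central_extension F E L \<omega>"
  shows "Z_star F L \<subseteq> \<omega> ` leibniz_center E"
proof (rule subsetI, rule ccontr)
  fix z assume z: "z \<in> Z_star F L" and nz: "z \<notin> \<omega> ` leibniz_center E"
  from ext have algE: "leibniz_algebra F E" and surj: "\<omega> ` carrier E = carrier L"
    unfolding central_extension_def leibniz_extension_def by auto
  interpret E: leibniz_algebra F E by fact
  have EF: "field F" "module F E" by (rule E.field_axioms E.module_axioms)+
  have mem: "z \<in> fst ` leibniz_center E'"
    if "central_extension F E' L fst" for E' :: "('f, 'l \<times> 'f) module"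
    using z that unfolding Z_star_def by blast
  have "z \<in> carrier L"
  proof -
    obtain E' :: "('f, 'l \<times> 'f) module" where
      E': "central_extension F E' L fst" "carrier E' = carrier L \<times> carrier F"
      by (rule cocycle_extension[OF ext, of "\<lambda>_. \<zero>"]) auto
    show ?thesis using mem[OF E'(1)] E'(2) by (auto simp: leibniz_center_def)
  qed
  then obtain e where e: "e \<in> carrier E" "z = \<omega> e" using surj by blast
  then have "e \<notin> leibniz_center E" using nz by blast
  then obtain x where x: "x \<in> carrier E" "e \<otimes>\<^bsub>E\<^esub> x \<noteq> \<zero>\<^bsub>E\<^esub> \<or> x \<otimes>\<^bsub>E\<^esub> e \<noteq> \<zero>\<^bsub>E\<^esub>"
    using e by (auto simp: leibniz_center_def)
  then obtain a where a: "a \<in> carrier E" "a \<noteq> \<zero>\<^bsub>E\<^esub>" "a = e \<otimes>\<^bsub>E\<^esub> x \<or> a = x \<otimes>\<^bsub>E\<^esub> e"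
    using e E.prod_closed by blast
  obtain \<phi> where \<phi>: "\<phi> \<in> carrier E \<rightarrow> carrier F" "\<phi> a = \<one>"
    "\<And>x y. x \<in> carrier E \<Longrightarrow> y \<in> carrier E \<Longrightarrow> \<phi> (x \<oplus>\<^bsub>E\<^esub> y) = \<phi> x \<oplus> \<phi> y"
    "\<And>c x. c \<in> carrier F \<Longrightarrow> x \<in> carrier E \<Longrightarrow> \<phi> (c \<odot>\<^bsub>E\<^esub> x) = c \<otimes> \<phi> x"
    using ex_linear_functional[OF EF a(1,2)] by blast
  obtain E' :: "('f, 'l \<times> 'f) module" where
    E': "central_extension F E' L fst" "carrier E' = carrier L \<times> carrier F" "\<zero>\<^bsub>E'\<^esub> = (\<zero>\<^bsub>L\<^esub>, \<zero>)"
    "\<And>x y s t. x \<in> carrier E \<Longrightarrow> y \<in> carrier E \<Longrightarrow>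
       (\<omega> x, s) \<otimes>\<^bsub>E'\<^esub> (\<omega> y, t) = (\<omega> (x \<otimes>\<^bsub>E\<^esub> y), \<phi> (x \<otimes>\<^bsub>E\<^esub> y))"
    using cocycle_extension[OF ext \<phi>(1,3,4)] by metis
  obtain t where t: "(\<omega> e, t) \<in> leibniz_center E'" using mem[OF E'(1)] e by auto
  have "(\<omega> x, \<zero>) \<in> carrier E'" using x surj E'(2) by auto
  then have "(\<omega> e, t) \<otimes>\<^bsub>E'\<^esub> (\<omega> x, \<zero>) = \<zero>\<^bsub>E'\<^esub>" "(\<omega> x, \<zero>) \<otimes>\<^bsub>E'\<^esub> (\<omega> e, t) = \<zero>\<^bsub>E'\<^esub>"
    using t by (auto simp: leibniz_center_def)
  then have "\<phi> a = \<zero>" using a(3) E'(3,4) e x by auto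
  then show False using \<phi>(2) by simp
qed

end

theory Submission
  imports Defs
begin

text \<open>Two inclusions are played against each other. A surjective homomorphism sends central
  elements to central elements (\<open>image_center_subset_center\<close>), so \<omega>(Z(E)) lies
  in Z(L). Conversely, Z*(L) lies in \<omega>(Z(E)) for every central extension
  (\<open>Z_star_subset_image_center\<close>), and the hypothesis places Z(L) inside Z*(L). Hence
  Z(L) \<subseteq> Z*(L) \<subseteq> \<omega>(Z(E)) \<subseteq> Z(L).\<close>

lemma image_center_subset_center:
  assumes "leibniz_extension F E L \<omega>"
  shows "\<omega> ` leibniz_center E \<subseteq> leibniz_center L"
proof
  fix y assume "y \<in> \<omega> ` leibniz_center E"
  then obtain z where z: "z \<in> leibniz_center E" and y: "y = \<omega> z" by blast
  interpret F: field F
    using assms by (simp add: leibniz_extension_def leibniz_algebra_def)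
  interpret E: module F E
    using assms by (simp add: leibniz_extension_def leibniz_algebra_def)
  interpret L: module F L
    using assms by (simp add: leibniz_extension_def leibniz_algebra_def)
  have surj: "\<omega> ` carrier E = carrier L"
    and w_smult: "\<And>a x. a \<in> carrier F \<Longrightarrow> x \<in> carrier E \<Longrightarrow> \<omega> (a \<odot>\<^bsub>E\<^esub> x) = a \<odot>\<^bsub>L\<^esub> \<omega> x"
    and w_prod: "\<And>x y. x \<in> carrier E \<Longrightarrow> y \<in> carrier E \<Longrightarrow> \<omega> (x \<otimes>\<^bsub>E\<^esub> y) = \<omega> x \<otimes>\<^bsub>L\<^esub> \<omega> y"
    using assms unfolding leibniz_extension_def leibniz_hom_def by auto
  have zc: "z \<in> carrier E" using z by (simp add: leibniz_center_def)
  \<comment> \<open>\<open>leibniz_hom\<close> does not list preservation of zero; it follows from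
    homogeneity, by scaling the zero vector by the zero scalar.\<close>
  have "\<omega> \<zero>\<^bsub>E\<^esub> \<in> carrier L" using surj by blast
  then have w0: "\<omega> \<zero>\<^bsub>E\<^esub> = \<zero>\<^bsub>L\<^esub>"
    using w_smult[OF F.zero_closed E.zero_closed] by simp
  have "y \<otimes>\<^bsub>L\<^esub> x = \<zero>\<^bsub>L\<^esub> \<and> x \<otimes>\<^bsub>L\<^esub> y = \<zero>\<^bsub>L\<^esub>" if x: "x \<in> carrier L" for x
  proof -
    \<comment> \<open>Surjectivity is essential here: once x is lifted to e, both products of y with
      x are images of products of z with e, which vanish because z is central.\<close>
    obtain e where e: "e \<in> carrier E" "x = \<omega> e" using x surj by blast
    have "y \<otimes>\<^bsub>L\<^esub> x = \<omega> (z \<otimes>\<^bsub>E\<^esub> e)" "x \<otimes>\<^bsub>L\<^esub> y = \<omega> (e \<otimes>\<^bsub>E\<^esub> z)"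
      using e zc y by (simp_all add: w_prod)
    moreover have "z \<otimes>\<^bsub>E\<^esub> e = \<zero>\<^bsub>E\<^esub>" "e \<otimes>\<^bsub>E\<^esub> z = \<zero>\<^bsub>E\<^esub>"
      using z e(1) by (auto simp: leibniz_center_def)
    ultimately show ?thesis using w0 by metis
  qed
  moreover have "y \<in> carrier L" using zc y surj by blast
  ultimately show "y \<in> leibniz_center L" by (simp add: leibniz_center_def)
qed

theorem theorem4p10:
  fixes F :: "('f, 'c) ring_scheme"
    and L :: "('f, 'l, 'm) module_scheme"
    and E :: "('f, 'e, 'n) module_scheme"
    and \<omega> :: "'e \<Rightarrow> 'l"
  assumes "leibniz_algebra F L"
    and "leibniz_center L \<subseteq> Z_star F L"
    and "stem_extension F E L \<omega>"
  shows "\<omega> ` leibniz_center E = leibniz_center L"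
proof
  have ext: "central_extension F E L \<omega>"
    using assms(3) by (simp add: stem_extension_def)
  then show "\<omega> ` leibniz_center E \<subseteq> leibniz_center L"
    unfolding central_extension_def by (blast intro: image_center_subset_center[THEN subsetD])
  \<comment> \<open>Unfolding \<open>Z_star\<close> would not suffice: its intersection only ranges
    over extensions with elements in \<open>'l \<times> 'f\<close>, while E lives on an arbitrary
    type. The adequacy theorem bridges this by transferring the products of E to a cocycle extension
    on that type.\<close>
  show "leibniz_center L \<subseteq> \<omega> ` leibniz_center E"
    using assms(2) Z_star_subset_image_center[OF ext] by blast
qed

end
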